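(* Let $f:\mathbb{R}^n\to\mathbb{R}$ be continuously differentiable with gradient Lipschitz continuous on the unit simplex $\Delta$ with constant $L>0$. Fix one rule among (FW), (AFW) and (PG) (described in the context) for the computation of $d^k_{N^k}$ in the algorithm AS-SIMPLEX (described in the context, where $d^k_{A^k}=0$). Then the resulting sequence of directions $\{d^k\}$ generated by AS-SIMPLEX is active-set gradient related.
   Context: Setting. $\Delta=\{x\in\mathbb{R}^n: e^Tx=1,\ x\ge 0\}$, where $e$ is the all-ones vector; $e_i$ is the $i$th unit vector; $v_I$ is the subvector of $v$ with components indexed by $I$. For $I\subseteq\{1,\dots,n\}$, $\Delta_I=\{x\in\Delta: x_i=0\ \forall i\notin I\}$. $P(x)_S$ is the Euclidean projection of $x$ on the non-empty closed convex set $S$. A point $x^*\in\Delta$ is stationary (for $\min_\Delta f$) if $\nabla f(x^* )^T(e_i-x^* )\ge 0$ for all $i=1,\dots,n$. A point $x^*\in\Delta_I$ is stationary in $\Delta_I$ if $\nabla f(x^* )^T(y-x^* )\ge0$ for all $y\in\Delta_I$. Active-set estimate. For $x\in\Delta$ and a fixed positive scalar $\epsilon$: $A(x)=\{i: x_i\le\epsilon\nabla f(x)^T(e_i-x)\}$, $N(x)=\{i: x_i>\epsilon\nabla f(x)^T(e_i-x)\}$, and $J(x)=\operatorname{Argmin}_{i=1,\dots,n}\nabla_i f(x)$. Algorithm AS-SIMPLEX. Choose $x^0\in\Delta$. For $k=0,1,\dots$: if $x^k$ is stationary, stop. Otherwise set $A^k=A(x^k)$, $N^k=N(x^k)$, choose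 $j\in J(x^k)$ (for non-stationary $x^k$ one has $J(x^k)\subseteq N(x^k)$), and set $\tilde x^k_{A^k}=0$, $\tilde x^k_{i}=x^k_{i}$ for $i\in N^k\setminus\{j\}$, $\tilde x^k_j=x^k_j+\sum_{h\in A^k}x^k_h$. Compute a feasible direction $d^k$ (at $\tilde x^k$) such that $d^k_{A^k}=0$. If $\nabla f(\tilde x^k)^Td^k<0$, compute a stepsize $\alpha^k\in(0,\alpha^k_{\max}]$ by means of a line search; otherwise set $\alpha^k=0$. Set $x^{k+1}=\tilde x^k+\alpha^kd^k$. Here $\alpha^k_{\max}$ is the maximum feasible stepsize that can be used along $d^k$ from $\tilde x^k$. Direction rules. (FW), Frank-Wolfe: $d^k_{N^k}=d^{\rm FW}_{N^k}=(e_{\hat\imath}-\tilde x^k)_{N^k}$ with $\hat\imath\in\operatorname{Argmin}_{i\in N^k}\nabla_if(\tilde x^k)$. (AFW), away-step Frank-Wolfe: $d^k_{N^k}=d^{\rm FW}_{N^k}$ if $\nabla_{N^k}f(\tilde x^k)^Td^{\rm FW}_{N^k}\le\nabla_{N^k}f(\tilde x^k)^Td^{\rm A}_{N^k}$, and $d^k_{N^k}=d^{\rm A}_{N^k}$ otherwise, where $d^{\rm A}_{N^k}=(\tilde x^k-e_{\hat\jmath})_{N^k}$ with $\hat\jmath\in\operatorname{Argmax}_{j\in N^k,\ \tilde x^k_j>0}\nabla_jf(\tilde x^k)$. (PG), projected gradient: $d^k_{N^k}=\bigl(P(\tilde x^k-s\nabla f(\tilde x^k))_{\Delta_{N^k}}-\tilde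 x^k\bigr)_{N^k}$ with a fixed scalar $s>0$. Active-set gradient related directions. Given an infinite sequence $\{x^k\}$ produced by AS-SIMPLEX, the sequence $\{d^k\}$ is active-set gradient related if, for any subsequence $\{x^k\}_K$ such that $N(x^k)=\hat N$ for all $k\in K$ and $\lim_{k\to\infty,\,k\in K}x^k=x^*$, where $x^*$ is non-stationary in $\Delta_{\hat N}$, one has: $\{d^k_{\hat N}\}_K$ is bounded; $\limsup_{k\to\infty,\,k\in K}\nabla_{\hat N}f(\tilde x^k)^Td^k_{\hat N}<0$; and $\liminf_{k\to\infty,\,k\in K}\alpha^k_{\max}>0$. *)

theory Defs
  imports "HOL-Analysis.Analysis"
begin

definition gradient :: "('a::euclidean_space \<Rightarrow> real) \<Rightarrow> 'a \<Rightarrow> 'a" where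
  "gradient f x = (THE D. GDERIV f x :> D)"

lemma GDERIV_gradient:
  fixes f :: "'a::euclidean_space \<Rightarrow> real"
  assumes "f differentiable (at x)"
  shows "GDERIV f x :> gradient f x"
proof -
  obtain f' where f': "(f has_derivative f') (at x)"
    using assms by (auto simp: differentiable_def)
  then have lin: "linear f'"
    by (rule has_derivative_linear)
  have "f' = (\<lambda>h. h \<bullet> adjoint f' 1)"
    using adjoint_works[OF lin] by (auto simp: fun_eq_iff)
  with f' have D: "GDERIV f x :> adjoint f' 1"
    by (simp add: gderiv_def)
  have "D' = adjoint f' 1" if "GDERIV f x :> D'" for D'
  proof -
    have "(\<lambda>h. h \<bullet> D') = (\<lambda>h. h \<bullet> adjoint f' 1)"
      using that D has_derivative_unique unfolding gderiv_def by blast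
    then show ?thesis
      by (metis vector_eq_ldot)
  qed
  with D show ?thesis
    unfolding gradient_def by (rule theI)
qed

definition unit_simplex :: "(real^'n) set" where
  "unit_simplex = {x. (\<Sum>i\<in>UNIV. x $ i) = 1 \<and> (\<forall>i. 0 \<le> x $ i)}"

definition simplex_face :: "'n set \<Rightarrow> (real^'n) set" where
  "simplex_face I = {x \<in> unit_simplex. \<forall>i. i \<notin> I \<longrightarrow> x $ i = 0}"

text \<open>The subvector of \<open>v\<close> indexed by \<open>I\<close> is padded with zeros outside \<open>I\<close>. Inner products,
  norms and equality of subvectors over the same index set are unaffected by this.\<close>

definition subvec :: "'n set \<Rightarrow> real^'n \<Rightarrow> real^'n" where
  "subvec I v = (\<chi> i. if i \<in> I then v $ i else 0)"

definition stationary :: "(real^'n \<Rightarrow> real) \<Rightarrow> real^'n \<Rightarrow> bool" where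
  "stationary f x \<longleftrightarrow> x \<in> unit_simplex \<and> (\<forall>i. 0 \<le> gradient f x \<bullet> (axis i 1 - x))"

definition stationary_in_face :: "(real^'n \<Rightarrow> real) \<Rightarrow> 'n set \<Rightarrow> real^'n \<Rightarrow> bool" where
  "stationary_in_face f I x \<longleftrightarrow>
     x \<in> simplex_face I \<and> (\<forall>y\<in>simplex_face I. 0 \<le> gradient f x \<bullet> (y - x))"

definition active :: "(real^'n \<Rightarrow> real) \<Rightarrow> real \<Rightarrow> real^'n \<Rightarrow> 'n set" where
  "active f \<epsilon> x = {i. x $ i \<le> \<epsilon> * (gradient f x \<bullet> (axis i 1 - x))}"

definition nonactive :: "(real^'n \<Rightarrow> real) \<Rightarrow> real \<Rightarrow> real^'n \<Rightarrow> 'n set" where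
  "nonactive f \<epsilon> x = {i. x $ i > \<epsilon> * (gradient f x \<bullet> (axis i 1 - x))}"

definition min_grad_indices :: "(real^'n \<Rightarrow> real) \<Rightarrow> real^'n \<Rightarrow> 'n set" where
  "min_grad_indices f x = {j. is_arg_min (\<lambda>i. gradient f x $ i) (\<lambda>i. True) j}"

text \<open>The point with tilde. The cases do not overlap in the algorithm, since the chosen \<open>j\<close> is
  non-active whenever \<open>x\<close> is a non-stationary point of the simplex.\<close>

definition shift_active :: "(real^'n \<Rightarrow> real) \<Rightarrow> real \<Rightarrow> 'n \<Rightarrow> real^'n \<Rightarrow> real^'n" where
  "shift_active f \<epsilon> j x =
     (\<chi> i. if i \<in> active f \<epsilon> x then 0
           else if i = j then x $ j + (\<Sum>h\<in>active f \<epsilon> x. x $ h)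
           else x $ i)"

definition feasible_direction :: "real^'n \<Rightarrow> real^'n \<Rightarrow> bool" where
  "feasible_direction x d \<longleftrightarrow> (\<exists>t>0. \<forall>\<alpha>\<in>{0..t}. x + \<alpha> *\<^sub>R d \<in> unit_simplex)"

text \<open>Extended-real valued: it is \<open>\<infinity>\<close> exactly when \<open>d = 0\<close> (for \<open>x\<close> in the simplex);
  otherwise the supremum is attained.\<close>

definition max_feasible_step :: "real^'n \<Rightarrow> real^'n \<Rightarrow> ereal" where
  "max_feasible_step x d = (SUP \<alpha>\<in>{\<alpha>. 0 \<le> \<alpha> \<and> x + \<alpha> *\<^sub>R d \<in> unit_simplex}. ereal \<alpha>)"

text \<open>In the direction rules, \<open>N\<close> is the set of non-active indices, \<open>xt\<close> is the shifted point,
  and only the components of \<open>d\<close> in \<open>N\<close> are constrained.\<close>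

definition fw_rule :: "(real^'n \<Rightarrow> real) \<Rightarrow> 'n set \<Rightarrow> real^'n \<Rightarrow> real^'n \<Rightarrow> bool" where
  "fw_rule f N xt d \<longleftrightarrow>
     (\<exists>i. is_arg_min (\<lambda>i. gradient f xt $ i) (\<lambda>i. i \<in> N) i \<and>
          subvec N d = subvec N (axis i 1 - xt))"

definition afw_rule :: "(real^'n \<Rightarrow> real) \<Rightarrow> 'n set \<Rightarrow> real^'n \<Rightarrow> real^'n \<Rightarrow> bool" where
  "afw_rule f N xt d \<longleftrightarrow>
     (\<exists>i j. is_arg_min (\<lambda>i. gradient f xt $ i) (\<lambda>i. i \<in> N) i \<and>
            is_arg_max (\<lambda>j. gradient f xt $ j) (\<lambda>j. j \<in> N \<and> xt $ j > 0) j \<and>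
            (let d_FW = subvec N (axis i 1 - xt);
                 d_A = subvec N (xt - axis j 1)
             in subvec N d =
                  (if subvec N (gradient f xt) \<bullet> d_FW \<le> subvec N (gradient f xt) \<bullet> d_A
                   then d_FW else d_A)))"

definition pg_rule ::
  "real \<Rightarrow> (real^'n \<Rightarrow> real) \<Rightarrow> 'n set \<Rightarrow> real^'n \<Rightarrow> real^'n \<Rightarrow> bool" where
  "pg_rule s f N xt d \<longleftrightarrow>
     subvec N d = subvec N (closest_point (simplex_face N) (xt - s *\<^sub>R gradient f xt) - xt)"

text \<open>The sequences \<open>x\<close>, \<open>xt\<close> (shifted points), \<open>d\<close> and \<open>\<alpha>\<close> form an infinite run of the
  algorithm, i.e. one in which the stopping test never succeeds. The line search is arbitrary.\<close>

definition as_simplex_run ::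
  "(real^'n \<Rightarrow> real) \<Rightarrow> real \<Rightarrow> ('n set \<Rightarrow> real^'n \<Rightarrow> real^'n \<Rightarrow> bool) \<Rightarrow>
   (nat \<Rightarrow> real^'n) \<Rightarrow> (nat \<Rightarrow> real^'n) \<Rightarrow> (nat \<Rightarrow> real^'n) \<Rightarrow> (nat \<Rightarrow> real) \<Rightarrow> bool" where
  "as_simplex_run f \<epsilon> rule x xt d \<alpha> \<longleftrightarrow>
     x 0 \<in> unit_simplex \<and>
     (\<forall>k. \<not> stationary f (x k) \<and>
          (\<exists>j\<in>min_grad_indices f (x k). xt k = shift_active f \<epsilon> j (x k)) \<and>
          feasible_direction (xt k) (d k) \<and>
          (\<forall>i\<in>active f \<epsilon> (x k). d k $ i = 0) \<and>
          rule (nonactive f \<epsilon> (x k)) (xt k) (d k) \<and>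
          (if gradient f (xt k) \<bullet> d k < 0
           then 0 < \<alpha> k \<and> ereal (\<alpha> k) \<le> max_feasible_step (xt k) (d k)
           else \<alpha> k = 0) \<and>
          x (Suc k) = xt k + \<alpha> k *\<^sub>R d k)"

text \<open>Stationarity in a face is only defined for points of that face, so a limit point that is
  non-stationary in the face is understood to belong to it.\<close>

definition active_set_gradient_related ::
  "(real^'n \<Rightarrow> real) \<Rightarrow> real \<Rightarrow>
   (nat \<Rightarrow> real^'n) \<Rightarrow> (nat \<Rightarrow> real^'n) \<Rightarrow> (nat \<Rightarrow> real^'n) \<Rightarrow> bool" where
  "active_set_gradient_related f \<epsilon> x xt d \<longleftrightarrow>
     (\<forall>K N x_lim. strict_mono K \<longrightarrow>
        (\<forall>m. nonactive f \<epsilon> (x (K m)) = N) \<longrightarrow>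
        (\<lambda>m. x (K m)) \<longlonglongrightarrow> x_lim \<longrightarrow>
        x_lim \<in> simplex_face N \<longrightarrow> \<not> stationary_in_face f N x_lim \<longrightarrow>
          bounded (range (\<lambda>m. subvec N (d (K m)))) \<and>
          limsup (\<lambda>m. ereal (subvec N (gradient f (xt (K m))) \<bullet> subvec N (d (K m)))) < 0 \<and>
          liminf (\<lambda>m. max_feasible_step (xt (K m)) (d (K m))) > 0)"

end

theory Submission
  imports Defs
begin

text \<open>Along the subsequence, the limit point vanishes outside \<open>N\<close>, so the mass moved by the shift
  tends to zero and the shifted points have the same limit. For (FW) and (AFW) the slope of \<open>d\<close>
  at the shifted point is at most that of \<open>y - xt\<close> for every \<open>y\<close> in the face, in particular for
  one that witnesses non-stationarity of the limit; for (PG) the slope is at most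
  \<open>- norm d ^ 2 / s\<close> and \<open>d\<close> depends continuously on the shifted point. The unit step is feasible
  unless \<open>d\<close> is an away direction \<open>xt - axis j 1\<close>. In that case the step \<open>xt $ j\<close> is feasible, and
  since \<open>j\<close> is non-active, \<open>xt $ j\<close> is at least about \<open>\<epsilon>\<close> times the negated slope of \<open>d\<close>, which is
  bounded away from zero.\<close>

section \<open>The simplex and its faces\<close>

lemma convex_unit_simplex: "convex (unit_simplex :: (real^'n) set)"
  unfolding convex_def unit_simplex_def
  by (auto simp: sum.distrib simp flip: sum_distrib_left)

lemma closed_unit_simplex: "closed (unit_simplex :: (real^'n) set)"
  unfolding unit_simplex_def
  by (intro closed_Collect_conj closed_Collect_all closed_Collect_eq closed_Collect_le continuous_intros)

lemma simplex_face_subset: "simplex_face N \<subseteq> unit_simplex"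
  by (auto simp: simplex_face_def)

lemma convex_simplex_face: "convex (simplex_face N :: (real^'n) set)"
  unfolding convex_def simplex_face_def
  using convex_unit_simplex by (auto simp: convex_def)

lemma closed_simplex_face: "closed (simplex_face N :: (real^'n) set)"
proof -
  have "simplex_face N = unit_simplex \<inter> (\<Inter>i\<in>-N. {x :: real^'n. x $ i = 0})"
    by (auto simp: simplex_face_def)
  moreover have "closed {x :: real^'n. x $ i = 0}" for i
    by (intro closed_Collect_eq continuous_intros)
  ultimately show ?thesis
    by (simp add: closed_Int closed_INT closed_unit_simplex)
qed

lemma axis_in_simplex_face: "i \<in> N \<Longrightarrow> axis i 1 \<in> simplex_face N"
  by (auto simp: simplex_face_def unit_simplex_def axis_def)

lemma norm_unit_simplex_le_1:
  assumes "x \<in> unit_simplex"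
  shows "norm x \<le> 1"
proof -
  have "norm x \<le> (\<Sum>i\<in>UNIV. \<bar>x $ i\<bar>)"
    by (rule norm_le_l1_cart)
  also have "\<dots> = 1"
    using assms by (simp add: unit_simplex_def)
  finally show ?thesis .
qed

lemma norm_diff_unit_simplex_le_2:
  assumes "x \<in> unit_simplex" "y \<in> unit_simplex"
  shows "norm (x - y) \<le> 2"
  using norm_triangle_ineq4[of x y] norm_unit_simplex_le_1[OF assms(1)] norm_unit_simplex_le_1[OF assms(2)]
  by linarith

text \<open>The entries of \<open>y\<close> are convex weights supported on \<open>N\<close>, so
  \<open>v \<bullet> y\<close> is a weighted average of the values \<open>v $ k\<close> with
  \<open>k \<in> N\<close>.\<close>

lemma inner_simplex_face_ge_min:
  assumes "is_arg_min (\<lambda>i. v $ i) (\<lambda>i. i \<in> N) i" "y \<in> simplex_face N"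
  shows "v $ i \<le> v \<bullet> y"
proof -
  have "v $ i = (\<Sum>k\<in>UNIV. v $ i * y $ k)"
    using assms(2) by (simp add: simplex_face_def unit_simplex_def flip: sum_distrib_left)
  also have "\<dots> \<le> (\<Sum>k\<in>UNIV. v $ k * y $ k)"
  proof (rule sum_mono)
    fix k
    show "v $ i * y $ k \<le> v $ k * y $ k"
      using assms by (cases "k \<in> N")
        (auto simp: simplex_face_def unit_simplex_def is_arg_min_linorder intro: mult_right_mono)
  qed
  finally show ?thesis
    by (simp add: inner_vec_def)
qed

section \<open>Padded subvectors\<close>

lemma subvec_eq_self: "(\<And>i. i \<notin> N \<Longrightarrow> v $ i = 0) \<Longrightarrow> subvec N v = v"
  by (auto simp: subvec_def vec_eq_iff)

text \<open>Together with \<open>subvec_eq_self\<close>, this reduces slopes between subvectors to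
  ordinary inner products, because all directions considered vanish outside
  \<open>N\<close>.\<close>

lemma inner_subvec: "subvec N v \<bullet> subvec N w = v \<bullet> subvec N w"
  by (auto simp: subvec_def inner_vec_def intro!: sum.cong)

lemma subvec_diff_simplex_face:
  assumes "x \<in> simplex_face N" "y \<in> simplex_face N"
  shows "subvec N (x - y) = x - y"
  using assms by (intro subvec_eq_self) (auto simp: simplex_face_def)

section \<open>The active-set estimate and the shift\<close>

lemma nonactive_eq: "nonactive f \<epsilon> x = - active f \<epsilon> x"
  by (auto simp: active_def nonactive_def)

text \<open>The slope towards vertex i is the i-th gradient entry minus a term independent of i, so
  an index of minimal gradient entry also has minimal slope. At a non-stationary point that slope is
  negative, hence below the nonnegative \<open>x $ j\<close> after scaling by \<epsilon>.\<close>

lemma min_grad_index_nonactive: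
  assumes "x \<in> unit_simplex" "\<not> stationary f x" "0 < \<epsilon>" "j \<in> min_grad_indices f x"
  shows "j \<in> nonactive f \<epsilon> x"
proof -
  obtain i where "gradient f x \<bullet> (axis i 1 - x) < 0"
    using assms(1,2) unfolding stationary_def not_le[symmetric] by blast
  moreover have "gradient f x $ j \<le> gradient f x $ i"
    using assms(4) by (auto simp: min_grad_indices_def is_arg_min_linorder)
  ultimately have "gradient f x \<bullet> (axis j 1 - x) < 0"
    by (simp add: inner_diff_right inner_axis)
  then have "\<epsilon> * (gradient f x \<bullet> (axis j 1 - x)) < 0"
    using assms(3) by (simp add: mult_pos_neg)
  moreover have "0 \<le> x $ j"
    using assms(1) by (simp add: unit_simplex_def)
  ultimately show ?thesis
    by (simp add: nonactive_def)
qed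

text \<open>The shift only moves the active mass to \<open>j\<close>. Since \<open>j\<close> is
  itself non-active, none of this mass is lost and the total stays 1.\<close>

lemma shift_active_in_face:
  assumes "x \<in> unit_simplex" "j \<in> nonactive f \<epsilon> x"
  shows "shift_active f \<epsilon> j x \<in> simplex_face (nonactive f \<epsilon> x)"
proof -
  let ?A = "active f \<epsilon> x" and ?s = "shift_active f \<epsilon> j x"
  have j: "j \<in> - ?A"
    using assms(2) by (simp add: nonactive_eq)
  have nonneg: "0 \<le> x $ i" for i
    using assms(1) by (simp add: unit_simplex_def)
  have split: "sum g UNIV = sum g ?A + (g j + sum g (- ?A - {j}))" for g :: "'a \<Rightarrow> real"
  proof -
    have "sum g UNIV = sum g ?A + sum g (- ?A)"
      by (subst sum.union_disjoint[symmetric]) auto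
    moreover have "sum g (- ?A) = g j + sum g (- ?A - {j})"
      using j by (intro sum.remove) auto
    ultimately show ?thesis
      by simp
  qed
  have "(\<Sum>i\<in>?A. ?s $ i) = 0"
    by (simp add: shift_active_def)
  moreover have "?s $ j = x $ j + (\<Sum>h\<in>?A. x $ h)"
    using j by (simp add: shift_active_def)
  moreover have "(\<Sum>i\<in>- ?A - {j}. ?s $ i) = (\<Sum>i\<in>- ?A - {j}. x $ i)"
    by (intro sum.cong) (auto simp: shift_active_def)
  ultimately have "(\<Sum>i\<in>UNIV. ?s $ i) = (\<Sum>i\<in>UNIV. x $ i)"
    unfolding split by simp
  also have "\<dots> = 1"
    using assms(1) by (simp add: unit_simplex_def)
  finally show ?thesis
    using nonneg
    by (auto simp: simplex_face_def unit_simplex_def shift_active_def nonactive_eq sum_nonneg)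
qed

lemma shift_active_component_ge:
  assumes "x \<in> unit_simplex" "i \<in> nonactive f \<epsilon> x"
  shows "x $ i \<le> shift_active f \<epsilon> j x $ i"
  using assms by (auto simp: shift_active_def nonactive_eq unit_simplex_def intro!: sum_nonneg)

text \<open>An active component loses its own value, one summand of the active mass; component
  \<open>j\<close>, if non-active, gains the whole active mass; all others are unchanged.\<close>

lemma shift_active_dist_component:
  assumes "x \<in> unit_simplex"
  shows "\<bar>shift_active f \<epsilon> j x $ i - x $ i\<bar> \<le> (\<Sum>h\<in>active f \<epsilon> x. x $ h)"
  using assms by (auto simp: shift_active_def unit_simplex_def abs_of_nonneg intro!: sum_nonneg member_le_sum)

section \<open>Feasible step sizes\<close>

lemma step_le_max_feasible_step_in_simplex:
  assumes "y \<in> unit_simplex" "0 \<le> \<alpha>" "ereal \<alpha> \<le> max_feasible_step y d"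
  shows "y + \<alpha> *\<^sub>R d \<in> unit_simplex"
proof (rule ccontr)
  define S where "S = {\<beta>. y + \<beta> *\<^sub>R d \<in> unit_simplex}"
  assume "\<not> ?thesis"
  then have "\<alpha> \<in> - S"
    by (simp add: S_def)
  have "S = (\<lambda>\<beta>. y + \<beta> *\<^sub>R d) -` unit_simplex"
    by (auto simp: S_def)
  also have "closed \<dots>"
    by (intro closed_vimage closed_unit_simplex continuous_intros)
  finally have "open (- S)"
    by (simp add: open_Compl)
  then obtain e where e: "e > 0" "ball \<alpha> e \<subseteq> - S"
    using \<open>\<alpha> \<in> - S\<close> by (meson openE)
  \<comment> \<open>Closedness of the simplex makes a whole interval around \<alpha> infeasible, and
    convexity excludes feasible steps beyond \<alpha>. All feasible steps then stay a distance
    \<open>e\<close> below \<alpha>, so their supremum cannot reach \<alpha>.\<close>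
  have "\<beta> \<le> \<alpha> - e" if "0 \<le> \<beta>" "\<beta> \<in> S" for \<beta>
  proof (rule ccontr)
    assume "\<not> \<beta> \<le> \<alpha> - e"
    moreover have "\<beta> < \<alpha>"
    proof (rule ccontr)
      assume "\<not> \<beta> < \<alpha>"
      then have "\<alpha> \<le> \<beta>" by simp
      show False
      proof (cases "\<beta> = 0")
        case True
        then show False
          using that \<open>\<alpha> \<in> - S\<close> \<open>\<alpha> \<le> \<beta>\<close> assms(2) by simp
      next
        case False
        \<comment> \<open>The point at step \<alpha> lies on the segment from \<open>y\<close> to
          the feasible point at the longer step \<beta>.\<close>
        have "(1 - \<alpha> / \<beta>) *\<^sub>R y + (\<alpha> / \<beta>) *\<^sub>R (y + \<beta> *\<^sub>R d) \<in> unit_simplex"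
          using that False \<open>\<alpha> \<le> \<beta>\<close> assms(1,2)
          by (intro convexD[OF convex_unit_simplex]) (auto simp: S_def)
        moreover have "(1 - \<alpha> / \<beta>) *\<^sub>R y + (\<alpha> / \<beta>) *\<^sub>R (y + \<beta> *\<^sub>R d) = y + \<alpha> *\<^sub>R d"
          using False by (simp add: algebra_simps)
        ultimately show False
          using \<open>\<alpha> \<in> - S\<close> by (simp add: S_def)
      qed
    qed
    ultimately have "\<beta> \<in> ball \<alpha> e"
      by (simp add: dist_real_def)
    then show False
      using e(2) that(2) by blast
  qed
  then have "max_feasible_step y d \<le> ereal (\<alpha> - e)"
    unfolding max_feasible_step_def by (intro SUP_least) (auto simp: S_def)
  then have "ereal \<alpha> \<le> ereal (\<alpha> - e)"
    using assms(3) by (rule order_trans[rotated])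
  with e(1) show False
    by simp
qed

lemma max_feasible_step_ge:
  assumes "0 \<le> \<alpha>" "y + \<alpha> *\<^sub>R d \<in> unit_simplex"
  shows "ereal \<alpha> \<le> max_feasible_step y d"
  unfolding max_feasible_step_def using assms by (intro SUP_upper) simp

text \<open>At step y_j, component j becomes y_j * y_j and every other component y_i is multiplied
  by 1 + y_j, so all stay nonnegative. For y_j < 1 the exact maximum is y_j / (1 - y_j); the smaller
  step avoids the division.\<close>

lemma max_feasible_step_away_ge:
  assumes "y \<in> unit_simplex"
  shows "ereal (y $ j) \<le> max_feasible_step y (y - axis j 1)"
proof (rule max_feasible_step_ge)
  show j: "0 \<le> y $ j"
    using assms by (simp add: unit_simplex_def)
  have "(\<Sum>i\<in>UNIV. (y + (y $ j) *\<^sub>R (y - axis j 1)) $ i)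
      = (\<Sum>i\<in>UNIV. y $ i) + y $ j * ((\<Sum>i\<in>UNIV. y $ i) - (\<Sum>i\<in>UNIV. axis j 1 $ i))"
    by (simp add: sum.distrib sum_subtractf sum_distrib_left right_diff_distrib)
  also have "\<dots> = 1"
    using assms by (simp add: unit_simplex_def axis_def)
  finally have "(\<Sum>i\<in>UNIV. (y + (y $ j) *\<^sub>R (y - axis j 1)) $ i) = 1" .
  moreover have "0 \<le> (y + (y $ j) *\<^sub>R (y - axis j 1)) $ i" for i
    using assms j by (auto simp: unit_simplex_def axis_def algebra_simps)
  ultimately show "y + (y $ j) *\<^sub>R (y - axis j 1) \<in> unit_simplex"
    by (simp add: unit_simplex_def)
qed

section \<open>Invariants of a run and the limit of the shifted points\<close>

lemma as_simplex_run_in_simplex: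
  assumes run: "as_simplex_run f \<epsilon> rule x xt d \<alpha>" and "0 < \<epsilon>"
  shows "x k \<in> unit_simplex"
proof (induction k)
  case 0
  then show ?case
    using run by (simp add: as_simplex_run_def)
next
  case (Suc k)
  obtain j where "j \<in> min_grad_indices f (x k)" "xt k = shift_active f \<epsilon> j (x k)"
    and "\<not> stationary f (x k)"
    using run by (auto simp: as_simplex_run_def)
  then have xt: "xt k \<in> unit_simplex"
    using shift_active_in_face min_grad_index_nonactive Suc \<open>0 < \<epsilon>\<close> simplex_face_subset
    by (metis subsetD)
  have eq: "x (Suc k) = xt k + \<alpha> k *\<^sub>R d k"
    and \<alpha>: "\<alpha> k = 0 \<or> 0 < \<alpha> k \<and> ereal (\<alpha> k) \<le> max_feasible_step (xt k) (d k)"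
    using run unfolding as_simplex_run_def by metis+
  from \<alpha> xt show ?case
    unfolding eq by (auto intro: step_le_max_feasible_step_in_simplex)
qed

lemma as_simplex_run_shift:
  assumes "as_simplex_run f \<epsilon> rule x xt d \<alpha>" and "0 < \<epsilon>"
  obtains j where "j \<in> nonactive f \<epsilon> (x k)" "xt k = shift_active f \<epsilon> j (x k)"
  using assms(1) as_simplex_run_in_simplex[OF assms] min_grad_index_nonactive[OF _ _ assms(2)]
  unfolding as_simplex_run_def by metis

lemma as_simplex_run_shift_in_face:
  assumes "as_simplex_run f \<epsilon> rule x xt d \<alpha>" and "0 < \<epsilon>"
  shows "xt k \<in> simplex_face (nonactive f \<epsilon> (x k))"
  by (metis as_simplex_run_shift[OF assms] shift_active_in_face as_simplex_run_in_simplex[OF assms])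

lemma as_simplex_run_subvec_direction:
  assumes "as_simplex_run f \<epsilon> rule x xt d \<alpha>"
  shows "subvec (nonactive f \<epsilon> (x k)) (d k) = d k"
  using assms by (intro subvec_eq_self) (auto simp: as_simplex_run_def nonactive_eq)

lemma shift_tendsto:
  fixes x xt :: "nat \<Rightarrow> real^'n"
  assumes lim: "x \<longlonglongrightarrow> x_lim" and face: "x_lim \<in> simplex_face N"
    and N: "\<And>m. nonactive f \<epsilon> (x m) = N"
    and x: "\<And>m. x m \<in> unit_simplex"
    and xt: "\<And>m. \<exists>j. xt m = shift_active f \<epsilon> j (x m)"
  shows "xt \<longlonglongrightarrow> x_lim"
proof -
  \<comment> \<open>With the non-active set constant, the moved mass is a sum over a fixed index set
    and is therefore continuous in the point.\<close>
  have A: "active f \<epsilon> (x m) = - N" for m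
    using N[of m] by (auto simp: nonactive_eq)
  have "(\<lambda>m. \<Sum>h\<in>-N. x m $ h) \<longlonglongrightarrow> (\<Sum>h\<in>-N. x_lim $ h)"
    by (intro tendsto_intros lim)
  moreover have "(\<Sum>h\<in>-N. x_lim $ h) = 0"
    using face by (simp add: simplex_face_def)
  ultimately have mass: "(\<lambda>m. \<Sum>h\<in>-N. x m $ h) \<longlonglongrightarrow> 0"
    by simp
  have "(\<lambda>m. xt m $ i - x m $ i) \<longlonglongrightarrow> 0" for i
  proof (rule Lim_null_comparison[OF _ mass], rule always_eventually, rule allI)
    fix m
    show "norm (xt m $ i - x m $ i) \<le> (\<Sum>h\<in>-N. x m $ h)"
      using shift_active_dist_component[OF x[of m], of f \<epsilon> _ i] xt[of m]
      unfolding A by auto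
  qed
  then have "(\<lambda>m. (xt m $ i - x m $ i) + x m $ i) \<longlonglongrightarrow> 0 + x_lim $ i" for i
    by (intro tendsto_add tendsto_vec_nth lim)
  then show ?thesis
    by (intro vec_tendstoI) simp
qed

section \<open>Directions produced by the three rules\<close>

text \<open>A common form for all three rules that keeps only what the step bound needs: either the
  unit step stays in the face, or the direction points away from a vertex of the face. The second
  case arises only for (AFW).\<close>

definition toward_or_away :: "'n set \<Rightarrow> real^'n \<Rightarrow> real^'n \<Rightarrow> bool" where
  "toward_or_away N y d \<longleftrightarrow> y + d \<in> simplex_face N \<or> (\<exists>j\<in>N. d = y - axis j 1)"

lemma norm_toward_or_away_le_2:
  assumes "toward_or_away N y d" "y \<in> simplex_face N"
  shows "norm d \<le> 2"
  using assms(1) unfolding toward_or_away_def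
proof (elim disjE bexE)
  assume "y + d \<in> simplex_face N"
  then show ?thesis
    using norm_diff_unit_simplex_le_2[of "y + d" y] assms(2) by (auto simp: simplex_face_def)
next
  fix j
  assume "j \<in> N" "d = y - axis j 1"
  then show ?thesis
    using norm_diff_unit_simplex_le_2[of y "axis j 1"] axis_in_simplex_face[of j N] assms(2)
    by (auto simp: simplex_face_def)
qed

text \<open>A linear function on the face attains its minimum at a vertex, and the rule picks such a
  vertex. The second claim allows comparison with any competitor \<open>z\<close>, in particular one
  fixed along the whole subsequence.\<close>

lemma fw_rule_direction:
  assumes "fw_rule f N y d" "y \<in> simplex_face N" "subvec N d = d"
  shows "toward_or_away N y d"
    and "\<And>z. z \<in> simplex_face N \<Longrightarrow> gradient f y \<bullet> d \<le> gradient f y \<bullet> (z - y)"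
proof -
  obtain i where i: "is_arg_min (\<lambda>i. gradient f y $ i) (\<lambda>i. i \<in> N) i"
    and d: "subvec N d = subvec N (axis i 1 - y)"
    using assms(1) by (auto simp: fw_rule_def)
  have ax: "axis i 1 \<in> simplex_face N"
    using i by (auto simp: is_arg_min_def intro: axis_in_simplex_face)
  have "d = axis i 1 - y"
    using d subvec_diff_simplex_face[OF ax assms(2)] assms(3) by simp
  then show "toward_or_away N y d"
    and "\<And>z. z \<in> simplex_face N \<Longrightarrow> gradient f y \<bullet> d \<le> gradient f y \<bullet> (z - y)"
    using ax inner_simplex_face_ge_min[OF i]
    by (auto simp: toward_or_away_def inner_diff_right inner_axis)
qed

lemma afw_rule_direction:
  assumes "afw_rule f N y d" "y \<in> simplex_face N" "subvec N d = d"
  shows "toward_or_away N y d"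
    and "\<And>z. z \<in> simplex_face N \<Longrightarrow> gradient f y \<bullet> d \<le> gradient f y \<bullet> (z - y)"
proof -
  obtain i j where i: "is_arg_min (\<lambda>i. gradient f y $ i) (\<lambda>i. i \<in> N) i"
    and j: "is_arg_max (\<lambda>j. gradient f y $ j) (\<lambda>j. j \<in> N \<and> y $ j > 0) j"
    and d: "subvec N d = (if gradient f y \<bullet> subvec N (axis i 1 - y) \<le> gradient f y \<bullet> subvec N (y - axis j 1)
              then subvec N (axis i 1 - y) else subvec N (y - axis j 1))"
    using assms(1) by (auto simp: afw_rule_def Let_def inner_subvec)
  have iN: "i \<in> N" and jN: "j \<in> N"
    using i j by (auto simp: is_arg_min_def is_arg_max_def)
  have d': "d = (if gradient f y \<bullet> (axis i 1 - y) \<le> gradient f y \<bullet> (y - axis j 1)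
              then axis i 1 - y else y - axis j 1)"
    using d assms(3)
    unfolding subvec_diff_simplex_face[OF axis_in_simplex_face[OF iN] assms(2)]
      subvec_diff_simplex_face[OF assms(2) axis_in_simplex_face[OF jN]] by simp
  then show "toward_or_away N y d"
    using jN axis_in_simplex_face[OF iN] by (auto simp: toward_or_away_def)
  \<comment> \<open>The away direction is taken only when its slope is smaller, so the Frank-Wolfe
    bound carries over.\<close>
  have "gradient f y \<bullet> d \<le> gradient f y \<bullet> (axis i 1 - y)"
    using d' by auto
  then show "gradient f y \<bullet> d \<le> gradient f y \<bullet> (z - y)" if "z \<in> simplex_face N" for z
    using inner_simplex_face_ge_min[OF i that] by (simp add: inner_diff_right inner_axis)
qed

lemma pg_rule_direction:
  assumes "pg_rule s f N y d" "y \<in> simplex_face N" "subvec N d = d"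
  shows "d = closest_point (simplex_face N) (y - s *\<^sub>R gradient f y) - y"
proof -
  have "closest_point (simplex_face N) (y - s *\<^sub>R gradient f y) \<in> simplex_face N"
    using assms(2) by (intro closest_point_in_set closed_simplex_face) auto
  then show ?thesis
    using assms subvec_diff_simplex_face by (metis pg_rule_def)
qed

text \<open>Everything follows from the variational inequality of the projection \<open>p\<close>.
  If \<open>p = y\<close>, it would contradict the descent witness; otherwise, tested at
  \<open>y\<close>, it bounds the squared length of \<open>p - y\<close> by \<open>- s\<close> times
  the slope.\<close>

lemma projected_gradient_descent:
  fixes S :: "'a::euclidean_space set"
  assumes "convex S" "closed S" "y \<in> S" "0 < s"
    and nonstat: "\<exists>z\<in>S. g \<bullet> (z - y) < 0"
  shows "g \<bullet> (closest_point S (y - s *\<^sub>R g) - y) < 0"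
proof -
  define p where "p = closest_point S (y - s *\<^sub>R g)"
  have var: "(y - s *\<^sub>R g - p) \<bullet> (z - p) \<le> 0" if "z \<in> S" for z
    unfolding p_def by (rule closest_point_dot[OF assms(1,2) that])
  obtain z where z: "z \<in> S" "g \<bullet> (z - y) < 0"
    using nonstat by blast
  have "p \<noteq> y"
  proof
    assume "p = y"
    then have "0 \<le> s * (g \<bullet> (z - y))"
      using var[OF z(1)] by simp
    then show False
      using z(2) \<open>0 < s\<close> by (simp add: zero_le_mult_iff)
  qed
  then have "0 < (p - y) \<bullet> (p - y)"
    by simp
  also have "\<dots> \<le> - s * (g \<bullet> (p - y))"
    using var[OF assms(3)] by (simp add: algebra_simps inner_commute)
  finally show ?thesis
    using \<open>0 < s\<close> by (simp add: p_def mult_less_0_iff)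
qed

section \<open>Uniform lower bound on the maximum feasible step\<close>

lemma eventually_le_half_limit:
  fixes u :: "nat \<Rightarrow> real"
  assumes "u \<longlonglongrightarrow> l" "l < 0"
  shows "\<forall>\<^sub>F m in sequentially. u m \<le> l / 2"
proof -
  have "\<forall>\<^sub>F m in sequentially. u m < l / 2"
    using assms by (intro order_tendstoD(2)[OF assms(1)]) simp
  then show ?thesis
    by eventually_elim simp
qed

lemma eventually_max_feasible_step_ge:
  fixes x xt d :: "nat \<Rightarrow> real^'n" and f :: "real^'n \<Rightarrow> real"
  assumes cont: "continuous_on UNIV (gradient f)" and "0 < \<epsilon>" "c < 0"
    and lim: "x \<longlonglongrightarrow> x_lim" "xt \<longlonglongrightarrow> x_lim"
    and N: "\<And>m. nonactive f \<epsilon> (x m) = N"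
    and face: "\<And>m. xt m \<in> simplex_face N"
    and ge: "\<And>m i. i \<in> N \<Longrightarrow> x m $ i \<le> xt m $ i"
    and dir: "\<And>m. toward_or_away N (xt m) (d m)"
    and descent: "\<forall>\<^sub>F m in sequentially. gradient f (xt m) \<bullet> d m \<le> c"
  shows "\<forall>\<^sub>F m in sequentially. ereal (min 1 (\<epsilon> * (- c / 2))) \<le> max_feasible_step (xt m) (d m)"
proof -
  have grad: "(\<lambda>m. gradient f (y m)) \<longlonglongrightarrow> gradient f x_lim" if "y \<longlonglongrightarrow> x_lim" for y
    using continuous_on_tendsto_compose[OF cont that] by simp
  \<comment> \<open>The active-set estimate is evaluated at \<open>x m\<close>, the direction at
    \<open>xt m\<close>. Both slopes towards vertex \<open>j\<close> have the same limit, so the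
    transfer costs less than \<open>- c / 2\<close>, half of the available descent.\<close>
  have "\<forall>\<^sub>F m in sequentially.
      c / 2 < gradient f (x m) \<bullet> (axis j 1 - x m) - gradient f (xt m) \<bullet> (axis j 1 - xt m)" for j
  proof -
    have "(\<lambda>m. gradient f (x m) \<bullet> (axis j 1 - x m) - gradient f (xt m) \<bullet> (axis j 1 - xt m))
        \<longlonglongrightarrow> gradient f x_lim \<bullet> (axis j 1 - x_lim) - gradient f x_lim \<bullet> (axis j 1 - x_lim)"
      by (intro tendsto_intros grad lim)
    then show ?thesis
      using \<open>c < 0\<close> by (intro order_tendstoD(1)) auto
  qed
  \<comment> \<open>The vertex of an away direction may vary with \<open>m\<close>; finiteness of
    the index set makes the bound uniform in it.\<close>
  then have "\<forall>\<^sub>F m in sequentially. \<forall>j.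
      c / 2 < gradient f (x m) \<bullet> (axis j 1 - x m) - gradient f (xt m) \<bullet> (axis j 1 - xt m)"
    by (rule eventually_all_finite)
  then show ?thesis
    using descent
  proof eventually_elim
    case (elim m)
    have xt: "xt m \<in> unit_simplex"
      using face simplex_face_subset by blast
    from dir[of m] show ?case
      unfolding toward_or_away_def
    proof (elim disjE bexE)
      assume "xt m + d m \<in> simplex_face N"
      then have "ereal 1 \<le> max_feasible_step (xt m) (d m)"
        using simplex_face_subset by (intro max_feasible_step_ge) auto
      then show ?thesis
        by (rule order_trans[rotated]) simp
    next
      fix j
      assume j: "j \<in> N" "d m = xt m - axis j 1"
      \<comment> \<open>An away direction is the negative of the direction towards its vertex, so
        descent by at least \<open>- c\<close> means ascent by at least \<open>- c\<close> towards
        the vertex at \<open>xt m\<close>; half of it survives at \<open>x m\<close>.\<close>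
      have "- c / 2 \<le> gradient f (x m) \<bullet> (axis j 1 - x m)"
        using elim(1)[rule_format, of j] elim(2) unfolding j(2) by (simp add: inner_diff_right)
      then have "\<epsilon> * (- c / 2) \<le> \<epsilon> * (gradient f (x m) \<bullet> (axis j 1 - x m))"
        using \<open>0 < \<epsilon>\<close> by (intro mult_left_mono) auto
      also have "\<dots> \<le> x m $ j"
        using j(1) N[of m] by (auto simp: nonactive_def)
      also have "\<dots> \<le> xt m $ j"
        using ge[OF j(1)] .
      finally have "min 1 (\<epsilon> * (- c / 2)) \<le> xt m $ j"
        by (rule min.coboundedI2)
      then have "ereal (min 1 (\<epsilon> * (- c / 2))) \<le> ereal (xt m $ j)"
        by (simp only: ereal_less_eq)
      also have "\<dots> \<le> max_feasible_step (xt m) (d m)"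
        unfolding j(2) by (rule max_feasible_step_away_ge[OF xt])
      finally show ?thesis .
    qed
  qed
qed

section \<open>Verification of the three conditions along a subsequence\<close>

theorem proposition3:
  fixes f :: "real^'n \<Rightarrow> real" and L \<epsilon> :: real
    and x xt d :: "nat \<Rightarrow> real^'n" and \<alpha> :: "nat \<Rightarrow> real"
    and rule :: "'n set \<Rightarrow> real^'n \<Rightarrow> real^'n \<Rightarrow> bool"
  assumes "f differentiable_on UNIV"
    and "continuous_on UNIV (gradient f)"
    and "0 < L" and "L-lipschitz_on unit_simplex (gradient f)"
    and "0 < \<epsilon>"
    and "rule \<in> {fw_rule f, afw_rule f} \<union> {pg_rule s f |s. 0 < s}"
    and "as_simplex_run f \<epsilon> rule x xt d \<alpha>"
  shows "active_set_gradient_related f \<epsilon> x xt d"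
  unfolding active_set_gradient_related_def
proof (intro allI impI)
  note cont = assms(2) and eps = assms(5) and run = assms(7)
  fix K :: "nat \<Rightarrow> nat" and N :: "'n set" and x_lim :: "real^'n"
  assume "strict_mono K" and N: "\<forall>m. nonactive f \<epsilon> (x (K m)) = N"
    and lim: "(\<lambda>m. x (K m)) \<longlonglongrightarrow> x_lim" and x_lim: "x_lim \<in> simplex_face N"
    and nonstat: "\<not> stationary_in_face f N x_lim"
  have shift: "\<exists>j. xt k = shift_active f \<epsilon> j (x k)" for k
    using as_simplex_run_shift[OF run eps] by blast
  have face: "xt (K m) \<in> simplex_face N" for m
    using as_simplex_run_shift_in_face[OF run eps] N by metis
  have d: "subvec N (d (K m)) = d (K m)" for m
    using as_simplex_run_subvec_direction[OF run] N by metis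
  have ge: "x (K m) $ i \<le> xt (K m) $ i" if "i \<in> N" for i m
    using shift[of "K m"] shift_active_component_ge[OF as_simplex_run_in_simplex[OF run eps]] N that
    by metis
  have rule_N: "rule N (xt (K m)) (d (K m))" for m
    using run N unfolding as_simplex_run_def by metis
  have xt_lim: "(\<lambda>m. xt (K m)) \<longlonglongrightarrow> x_lim"
    by (rule shift_tendsto[OF lim x_lim N[rule_format] as_simplex_run_in_simplex[OF run eps] shift])
  have grad_lim: "(\<lambda>m. gradient f (xt (K m))) \<longlonglongrightarrow> gradient f x_lim"
    using continuous_on_tendsto_compose[OF cont xt_lim] by simp
  obtain z where z: "z \<in> simplex_face N" "gradient f x_lim \<bullet> (z - x_lim) < 0"
    using nonstat x_lim unfolding stationary_in_face_def not_le[symmetric] by blast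
  \<comment> \<open>The rules differ only in how these two facts arise; the remaining argument is
    common to them.\<close>
  have "(\<forall>m. toward_or_away N (xt (K m)) (d (K m))) \<and>
    (\<exists>c<0. \<forall>\<^sub>F m in sequentially. gradient f (xt (K m)) \<bullet> d (K m) \<le> c)"
  proof (cases "\<exists>s>0. rule = pg_rule s f")
    case False
    then have disj: "rule = fw_rule f \<or> rule = afw_rule f"
      using assms(6) by blast
    have dir: "toward_or_away N (xt (K m)) (d (K m))"
      and le: "gradient f (xt (K m)) \<bullet> d (K m) \<le> gradient f (xt (K m)) \<bullet> (z - xt (K m))" for m
      using disj rule_N[of m] fw_rule_direction[OF _ face d] afw_rule_direction[OF _ face d] z(1)
      by metis+
    have "(\<lambda>m. gradient f (xt (K m)) \<bullet> (z - xt (K m))) \<longlonglongrightarrow> gradient f x_lim \<bullet> (z - x_lim)"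
      by (intro tendsto_intros grad_lim xt_lim)
    from eventually_le_half_limit[OF this z(2)]
    have "\<forall>\<^sub>F m in sequentially.
        gradient f (xt (K m)) \<bullet> d (K m) \<le> gradient f x_lim \<bullet> (z - x_lim) / 2"
      by eventually_elim (rule order_trans[OF le])
    with dir z(2) show ?thesis
      by (intro conjI allI exI[of _ "gradient f x_lim \<bullet> (z - x_lim) / 2"]) auto
  next
    case True
    then obtain s where s: "s > 0" "rule = pg_rule s f"
      by blast
    let ?P = "closest_point (simplex_face N)"
    let ?l = "gradient f x_lim \<bullet> (?P (x_lim - s *\<^sub>R gradient f x_lim) - x_lim)"
    have ne: "simplex_face N \<noteq> {}"
      using x_lim by blast
    have d_eq: "d (K m) = ?P (xt (K m) - s *\<^sub>R gradient f (xt (K m))) - xt (K m)" for m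
      using pg_rule_direction[OF _ face d] rule_N s(2) by metis
    have "xt (K m) + d (K m) \<in> simplex_face N" for m
      unfolding d_eq using closest_point_in_set[OF closed_simplex_face ne] by simp
    then have dir: "toward_or_away N (xt (K m)) (d (K m))" for m
      by (simp add: toward_or_away_def)
    \<comment> \<open>Here the slope is not compared with that of \<open>z\<close>. Continuity of
      the projection identifies the limit slope as that of the projected gradient direction at
      \<open>x_lim\<close>, where \<open>z\<close> shows it to be negative.\<close>
    have "isCont ?P (x_lim - s *\<^sub>R gradient f x_lim)"
      by (rule continuous_at_closest_point[OF convex_simplex_face closed_simplex_face ne])
    then have "(\<lambda>m. ?P (xt (K m) - s *\<^sub>R gradient f (xt (K m))))
        \<longlonglongrightarrow> ?P (x_lim - s *\<^sub>R gradient f x_lim)"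
      by (rule isCont_tendsto_compose) (intro tendsto_intros grad_lim xt_lim)
    then have "(\<lambda>m. gradient f (xt (K m)) \<bullet> d (K m)) \<longlonglongrightarrow> ?l"
      unfolding d_eq by (intro tendsto_intros grad_lim xt_lim)
    moreover have "?l < 0"
      using z by (intro projected_gradient_descent convex_simplex_face closed_simplex_face x_lim s(1)) blast
    ultimately have "\<forall>\<^sub>F m in sequentially. gradient f (xt (K m)) \<bullet> d (K m) \<le> ?l / 2"
      by (rule eventually_le_half_limit)
    with dir \<open>?l < 0\<close> show ?thesis
      by (intro conjI allI exI[of _ "?l / 2"]) auto
  qed
  then obtain c where dir: "\<And>m. toward_or_away N (xt (K m)) (d (K m))" and c: "c < 0"
    and descent: "\<forall>\<^sub>F m in sequentially. gradient f (xt (K m)) \<bullet> d (K m) \<le> c"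
    by blast
  show "bounded (range (\<lambda>m. subvec N (d (K m)))) \<and>
      limsup (\<lambda>m. ereal (subvec N (gradient f (xt (K m))) \<bullet> subvec N (d (K m)))) < 0 \<and>
      liminf (\<lambda>m. max_feasible_step (xt (K m)) (d (K m))) > 0"
  proof (intro conjI)
    show "bounded (range (\<lambda>m. subvec N (d (K m))))"
      unfolding d using norm_toward_or_away_le_2[OF dir face] by (auto simp: bounded_iff)
    \<comment> \<open>The constant \<open>c\<close> bounds all late slopes, so the upper limit stays
      strictly negative and not merely nonpositive.\<close>
    have "limsup (\<lambda>m. ereal (gradient f (xt (K m)) \<bullet> d (K m))) \<le> ereal c"
      using descent by (intro Limsup_bounded) simp
    also have "\<dots> < 0"
      using c by simp
    finally show "limsup (\<lambda>m. ereal (subvec N (gradient f (xt (K m))) \<bullet> subvec N (d (K m)))) < 0"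
      by (subst inner_subvec) (simp only: d)
    have "0 < ereal (min 1 (\<epsilon> * (- c / 2)))"
      using c eps by (simp add: mult_pos_neg)
    also have "\<dots> \<le> liminf (\<lambda>m. max_feasible_step (xt (K m)) (d (K m)))"
      using N
      by (intro Liminf_bounded eventually_max_feasible_step_ge[OF cont eps c lim xt_lim _ face ge dir descent])
        auto
    finally show "liminf (\<lambda>m. max_feasible_step (xt (K m)) (d (K m))) > 0" .
  qed
qed

end
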